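(* Fix the wavelength $\lambda>0$, the noise variance $\sigma_\eta^2>0$, the reference location $\mathbf{r}\in\mathbb{R}^3$ and the antenna positions $\mathbf{q}_0,\dots,\mathbf{q}_{N-1}\in\mathbb{R}^3$. Let the source have state $\mathbf{s}=[\mathbf{p}^{\mathsf T},\mathbf{v}^{\mathsf T}]^{\mathsf T}\in\mathbb{R}^6$ with position $\mathbf{p}\in\mathbb{R}^3$ and velocity $\mathbf{v}\in\mathbb{R}^3$, and let $d=\lVert\mathbf{p}-\mathbf{r}\rVert$. Let the measurement be $\mathbf{z}=h(\mathbf{p})+\boldsymbol{\eta}\in\mathbb{R}^N$ with $\boldsymbol{\eta}\sim\mathcal{N}(\mathbf{0},\sigma_\eta^2\mathbf{I}_N)$, where $h$ is the differential-phase observation function (defined in the context), and let $p(\mathbf{z}\mid\mathbf{s})$ be the corresponding likelihood, with the regularity convention on derivatives given in the context. Then the $6\times 6$ data Fisher information matrix satisfies $$\tilde{\mathbf{J}}^{\mathrm D}(\mathbf{s})\triangleq\mathbb{E}_{\mathbf{z}\mid\mathbf{s}}\left\{\nabla_{\mathbf{s}}^{\mathsf T}\ln p(\mathbf{z}\mid\mathbf{s})\,\nabla_{\mathbf{s}}\ln p(\mathbf{z}\mid\mathbf{s})\right\}=\frac{1}{\sigma_\eta^2}\,\nabla_{\mathbf{s}}^{\mathsf T}h(\mathbf{p})\,\nabla_{\mathbf{s}}h(\mathbf{p}),$$ and $$\tilde{\mathbf{J}}^{\mathrm D}(\mathbf{s})\longrightarrow\mathbf{0}_{6}\qquad\text{as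 } d\to\infty,$$ where $\mathbf{0}_6$ is the $6\times6$ zero matrix.
   Context: Observation model: an array of $N$ antennas at fixed positions $\mathbf{q}_n\in\mathbb{R}^3$, $n=0,\dots,N-1$, with a reference location $\mathbf{r}\in\mathbb{R}^3$, observes a source at $\mathbf{p}\in\mathbb{R}^3$. The observation function is $h(\mathbf{p})=[h_0(\mathbf{p}),\dots,h_{N-1}(\mathbf{p})]^{\mathsf T}$ with $$h_n(\mathbf{p})=\Delta\vartheta_n \bmod 2\pi,\qquad \Delta\vartheta_n=\frac{2\pi}{\lambda}\,\Delta d_n,\qquad \Delta d_n=\lVert\mathbf{p}-\mathbf{q}_n\rVert-\lVert\mathbf{p}-\mathbf{r}\rVert .$$ Thus $p(\mathbf{z}\mid\mathbf{s})$ is the Gaussian density $\mathcal{N}(\mathbf{z};h(\mathbf{p}),\sigma_\eta^2\mathbf{I}_N)$, which depends on $\mathbf{s}$ only through $\mathbf{p}$. Regularity convention: at the jump points of the modulo operation, the derivatives of $h_n$ are taken equal to the left and right derivatives; equivalently, in every derivative $h_n$ is replaced by $\Delta\vartheta_n$. The source does not coincide with $\mathbf{r}$ or with any antenna, so that these derivatives exist. Gradients $\nabla_{\mathbf{s}}$ of scalars are row vectors; $\nabla_{\mathbf{s}}h$ is the $N\times 6$ Jacobian matrix whose $n$th row is $\nabla_{\mathbf{s}}h_n$, and $\nabla_{\mathbf{s}}^{\mathsf T}h$ denotes its transpose. *)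

theory Defs
  imports "HOL-Analysis.Analysis" "HOL-Library.Real_Mod"
begin

definition state :: "real^3 \<Rightarrow> real^3 \<Rightarrow> real^6" where
  "state p v = vector [p$1, p$2, p$3, v$1, v$2, v$3]"

definition pos :: "real^6 \<Rightarrow> real^3" where
  "pos s = vector [s$1, s$2, s$3]"

definition phase_diff :: "real \<Rightarrow> real^3 \<Rightarrow> real^3 \<Rightarrow> real^3 \<Rightarrow> real" where
  "phase_diff lam q r p = 2 * pi / lam * (norm (p - q) - norm (p - r))"

definition obs :: "real \<Rightarrow> ('n::finite \<Rightarrow> real^3) \<Rightarrow> real^3 \<Rightarrow> real^3 \<Rightarrow> real^'n" where
  "obs lam q r p = (\<chi> n. phase_diff lam (q n) r p rmod (2 * pi))"

(* Derivatives at a point p0 are taken with every h_n replaced by the phase difference,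
   shifted by the constant (a multiple of 2 pi) that makes it agree with h_n at p0: the
   derivative of h_n becomes that of the phase difference, while the value h_n(p0), which
   enters the derivative of the log-likelihood, is unchanged. By obs_eq_obs_branch below this
   is the true derivative except at the jump points, where it is the common value of the
   one-sided derivatives of the two pieces of h_n. *)
definition obs_branch ::
  "real \<Rightarrow> ('n::finite \<Rightarrow> real^3) \<Rightarrow> real^3 \<Rightarrow> real^3 \<Rightarrow> real^3 \<Rightarrow> real^'n" where
  "obs_branch lam q r p0 p =
     (\<chi> n. phase_diff lam (q n) r p + (obs lam q r p0 $ n - phase_diff lam (q n) r p0))"

definition gaussian_density :: "real^'n::finite \<Rightarrow> real^'n^'n \<Rightarrow> real^'n \<Rightarrow> real" where
  "gaussian_density \<mu> \<Sigma> z =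
     exp (- (1/2) * ((z - \<mu>) \<bullet> (matrix_inv \<Sigma> *v (z - \<mu>)))) / sqrt ((2 * pi) ^ CARD('n) * det \<Sigma>)"

definition noise_law :: "real \<Rightarrow> (real^'n::finite) measure" where
  "noise_law \<sigma> = density lborel (\<lambda>x. ennreal (gaussian_density 0 (\<sigma>\<^sup>2 *\<^sub>R mat 1) x))"

definition obs_law ::
  "real \<Rightarrow> real \<Rightarrow> ('n::finite \<Rightarrow> real^3) \<Rightarrow> real^3 \<Rightarrow> real^6 \<Rightarrow> (real^'n) measure" where
  "obs_law \<sigma> lam q r s = distr (noise_law \<sigma>) borel (\<lambda>\<eta>. obs lam q r (pos s) + \<eta>)"

(* p(z|s) is the case h = obs lam q r. *)
definition likelihood ::
  "real \<Rightarrow> (real^3 \<Rightarrow> real^'n::finite) \<Rightarrow> real^6 \<Rightarrow> real^'n \<Rightarrow> real" where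
  "likelihood \<sigma> h s z = gaussian_density (h (pos s)) (\<sigma>\<^sup>2 *\<^sub>R mat 1) z"

(* The gradient of ln p(z|s) in s, a row vector, i.e. a 1 x 6 matrix. *)
definition score ::
  "real \<Rightarrow> real \<Rightarrow> ('n::finite \<Rightarrow> real^3) \<Rightarrow> real^3 \<Rightarrow> real^6 \<Rightarrow> real^'n \<Rightarrow> real^6^1" where
  "score \<sigma> lam q r s z =
     jacobian (\<lambda>s'. vec (ln (likelihood \<sigma> (obs_branch lam q r (pos s)) s' z))) (at s)"

definition obs_jacobian ::
  "real \<Rightarrow> ('n::finite \<Rightarrow> real^3) \<Rightarrow> real^3 \<Rightarrow> real^6 \<Rightarrow> real^6^'n" where
  "obs_jacobian lam q r s = jacobian (\<lambda>s'. obs_branch lam q r (pos s) (pos s')) (at s)"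

definition data_fisher ::
  "real \<Rightarrow> real \<Rightarrow> ('n::finite \<Rightarrow> real^3) \<Rightarrow> real^3 \<Rightarrow> real^6 \<Rightarrow> real^6^6" where
  "data_fisher \<sigma> lam q r s =
     (\<integral>z. transpose (score \<sigma> lam q r s z) ** score \<sigma> lam q r s z \<partial>obs_law \<sigma> lam q r s)"


lemma pos_state: "pos (state p v) = p"
  by (simp add: pos_def state_def vec_eq_iff forall_3 vector_def)

lemma state_surj: "\<exists>p v. s = state p v"
proof -
  have ex: "i = 1 \<or> i = 2 \<or> i = 3 \<or> i = 4 \<or> i = 5 \<or> i = 6" for i :: 6
  proof (induct i)
    case (of_int z)
    then have "z = 0 \<or> z = 1 \<or> z = 2 \<or> z = 3 \<or> z = 4 \<or> z = 5" by fastforce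
    then show ?case by auto
  qed
  have "s = state (vector [s$1, s$2, s$3]) (vector [s$4, s$5, s$6])"
    unfolding vec_eq_iff
  proof
    fix i :: 6
    show "s $ i = state (vector [s$1, s$2, s$3]) (vector [s$4, s$5, s$6]) $ i"
      using ex[of i] by (auto simp: state_def vector_def)
  qed
  then show ?thesis by blast
qed


lemma borel_measurable_gaussian_density [measurable]:
  "gaussian_density \<mu> \<Sigma> \<in> borel_measurable borel"
proof -
  have "continuous_on UNIV (\<lambda>z. matrix_inv \<Sigma> *v (z - \<mu>))"
    by (rule continuous_on_compose2[OF linear_continuous_on
          [OF matrix_vector_mul_bounded_linear]]) (auto intro!: continuous_intros)
  then have "continuous_on UNIV
      (\<lambda>z. exp (- (1/2) * ((z - \<mu>) \<bullet> (matrix_inv \<Sigma> *v (z - \<mu>)))))"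
    by (intro continuous_intros) auto
  then show ?thesis
    unfolding gaussian_density_def by (intro borel_measurable_divide borel_measurable_continuous_onI) auto
qed

lemma obs_law_density:
  "obs_law \<sigma> lam q r s = density lborel (\<lambda>z. ennreal (likelihood \<sigma> (obs lam q r) s z))"
proof -
  let ?c = "obs lam q r (pos s)"
  have shift: "gaussian_density 0 \<Sigma> x = gaussian_density ?c \<Sigma> (?c + x)" for \<Sigma> x
    by (simp add: gaussian_density_def)
  have "density lborel (\<lambda>z. ennreal (likelihood \<sigma> (obs lam q r) s z))
      = density (distr lborel borel ((+) ?c)) (\<lambda>z. ennreal (likelihood \<sigma> (obs lam q r) s z))"
    by (simp add: lborel_distr_plus)
  also have "\<dots> = distr (density lborel (\<lambda>x. ennreal (likelihood \<sigma> (obs lam q r) s (?c + x)))) borel ((+) ?c)"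
    unfolding likelihood_def by (subst density_distr) auto
  also have "\<dots> = obs_law \<sigma> lam q r s"
    by (simp add: obs_law_def noise_law_def likelihood_def shift)
  finally show ?thesis by simp
qed

lemma obs_branch_self [simp]: "obs_branch lam q r p p = obs lam q r p"
  by (simp add: obs_branch_def vec_eq_iff)

lemma obs_eq_obs_branch:
  "\<forall>\<^sub>F p' in nhds p. obs lam q r p' $ n = obs_branch lam q r p p' $ n +
     (if obs lam q r p $ n = 0 \<and> phase_diff lam (q n) r p' < phase_diff lam (q n) r p
      then 2 * pi else 0)"
proof -
  define f where "f x = phase_diff lam (q n) r x / (2 * pi)" for x
  define k where "k = \<lfloor>f p\<rfloor>"
  have phase: "phase_diff lam (q n) r x = 2 * pi * f x" for x
    by (simp add: f_def)
  have obs: "obs lam q r x $ n = 2 * pi * (f x - of_int \<lfloor>f x\<rfloor>)" for x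
    by (simp add: obs_def rmod_def f_def right_diff_distrib)
  have branch: "obs_branch lam q r p x $ n = 2 * pi * (f x - of_int k)" for x
  proof -
    have "obs_branch lam q r p x $ n = 2 * pi * f x + (2 * pi * (f p - of_int k) - 2 * pi * f p)"
      by (simp add: obs_branch_def obs phase k_def)
    then show ?thesis by (simp add: algebra_simps)
  qed
  have "isCont f p"
    unfolding f_def phase_diff_def by (intro continuous_intros) auto
  then have lim: "(f \<longlongrightarrow> f p) (nhds p)"
    by (simp add: continuous_at tendsto_at_iff_tendsto_nhds)
  have "real_of_int k - 1 < f p" "f p < real_of_int k + 1"
    unfolding k_def by linarith+
  then have "\<forall>\<^sub>F x in nhds p. real_of_int k - 1 < f x" and
       up: "\<forall>\<^sub>F x in nhds p. f x < real_of_int k + 1"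
    using order_tendstoD[OF lim] by auto
  moreover have "\<forall>\<^sub>F x in nhds p. real_of_int k < f x" if "f p \<noteq> real_of_int k"
  proof -
    have "real_of_int k < f p" using that unfolding k_def by linarith
    then show ?thesis using order_tendstoD[OF lim] by auto
  qed
  ultimately have "\<forall>\<^sub>F x in nhds p. real_of_int k - 1 < f x \<and> f x < real_of_int k + 1 \<and>
      (f p \<noteq> real_of_int k \<longrightarrow> real_of_int k < f x)"
    by (cases "f p = real_of_int k") (auto intro: eventually_conj)
  then show ?thesis
  proof eventually_elim
    case (elim x)
    have jump: "obs lam q r p $ n = 0 \<longleftrightarrow> f p = of_int k"
      by (simp add: obs k_def)
    show ?case
    proof (cases "f p = of_int k \<and> f x < f p")
      case True
      then have "\<lfloor>f x\<rfloor> = k - 1" using elim by (intro floor_unique) auto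
      then have "obs lam q r x $ n = 2 * pi * (f x - (of_int k - 1))"
        by (simp only: obs of_int_diff of_int_1)
      then show ?thesis
        using True unfolding jump by (simp add: branch phase algebra_simps)
    next
      case False
      then have "\<lfloor>f x\<rfloor> = k" using elim by (intro floor_unique) auto
      then show ?thesis
        using False unfolding jump by (auto simp: obs branch phase)
    qed
  qed
qed

lemma jacobian_eqI:
  assumes "\<And>f'. (f has_derivative f') F \<longleftrightarrow> (g has_derivative f') F"
  shows "jacobian f F = jacobian g F"
  using assms by (simp add: jacobian_def frechet_derivative_def)

lemma obs_jacobian_eq_phase_diff:
  "obs_jacobian lam q r s = jacobian (\<lambda>s'. \<chi> n. phase_diff lam (q n) r (pos s')) (at s)"
proof -
  define c where "c = (\<chi> n. obs lam q r (pos s) $ n - phase_diff lam (q n) r (pos s))"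
  have *: "obs_branch lam q r (pos s) (pos s') = (\<chi> n. phase_diff lam (q n) r (pos s')) + c" for s'
    by (simp add: obs_branch_def c_def vec_eq_iff)
  show ?thesis
    unfolding obs_jacobian_def *
  proof (rule jacobian_eqI)
    fix f' :: "real^6 \<Rightarrow> real^'a"
    show "((\<lambda>s'. (\<chi> n. phase_diff lam (q n) r (pos s')) + c) has_derivative f') (at s) \<longleftrightarrow>
      ((\<lambda>s'. \<chi> n. phase_diff lam (q n) r (pos s')) has_derivative f') (at s)"
      by (simp add: has_derivative_def)
  qed
qed

lemma bounded_linear_pos: "bounded_linear pos"
  by (intro linear_linear[THEN iffD2] linearI)
     (simp_all add: pos_def vec_eq_iff forall_3 vector_def)

lemma jump_free_derivatives:
  assumes "\<And>n. obs lam q r (pos s) $ n \<noteq> 0"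
  shows "obs_jacobian lam q r s = jacobian (\<lambda>s'. obs lam q r (pos s')) (at s)"
    and "score \<sigma> lam q r s z = jacobian (\<lambda>s'. vec (ln (likelihood \<sigma> (obs lam q r) s' z))) (at s)"
proof -
  have "(pos \<longlongrightarrow> pos s) (nhds s)"
    using linear_continuous_at[OF bounded_linear_pos]
    by (simp add: continuous_at tendsto_at_iff_tendsto_nhds)
  moreover have "\<forall>\<^sub>F p' in nhds (pos s). \<forall>n. obs lam q r p' $ n = obs_branch lam q r (pos s) p' $ n"
    using obs_eq_obs_branch[of lam q r _ "pos s"] assms by (intro eventually_all_finite) simp
  ultimately have "\<forall>\<^sub>F s' in nhds s. \<forall>n. obs lam q r (pos s') $ n = obs_branch lam q r (pos s) (pos s') $ n"
    by (rule eventually_compose_filterlim[rotated])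
  then have ev: "\<forall>\<^sub>F s' in nhds s. obs_branch lam q r (pos s) (pos s') = obs lam q r (pos s')"
    by (rule eventually_mono) (simp add: vec_eq_iff)
  have eq: "jacobian f (at s) = jacobian g (at s)"
    if "\<forall>\<^sub>F s' in nhds s. f s' = g s'" for f g :: "real^6 \<Rightarrow> real^'k"
  proof (rule jacobian_eqI)
    have "f s = g s" using that by (rule eventually_nhds_x_imp_x)
    moreover have "\<forall>\<^sub>F s' in at s. f s' = g s'"
      using that by (simp add: eventually_at_filter eventually_mono)
    moreover from this have "\<forall>\<^sub>F s' in at s. g s' = f s'"
      by (auto elim: eventually_mono)
    ultimately show "(f has_derivative f') (at s) \<longleftrightarrow> (g has_derivative f') (at s)" for f'
      using has_derivative_transform_eventually[of f f' s UNIV g]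
            has_derivative_transform_eventually[of g f' s UNIV f] by auto
  qed
  show "obs_jacobian lam q r s = jacobian (\<lambda>s'. obs lam q r (pos s')) (at s)"
    unfolding obs_jacobian_def using ev by (rule eq)
  show "score \<sigma> lam q r s z = jacobian (\<lambda>s'. vec (ln (likelihood \<sigma> (obs lam q r) s' z))) (at s)"
    unfolding score_def
    by (rule eq, rule eventually_mono[OF ev]) (simp add: likelihood_def)
qed

lemma obs_branch_differentiable:
  assumes "pos s \<noteq> r" "\<And>n. pos s \<noteq> q n"
  shows "(\<lambda>s'. obs_branch lam q r p0 (pos s')) differentiable (at s)"
proof -
  have pos: "pos differentiable (at s)"
    by (rule linear_imp_differentiable) (rule bounded_linear.linear[OF bounded_linear_pos])
  have nrm: "(\<lambda>s'. norm (pos s' - a)) differentiable (at s)" if "pos s \<noteq> a" for a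
  proof -
    have "(\<lambda>s'. pos s' - a) differentiable (at s)"
      by (rule differentiable_diff[OF pos differentiable_const])
    moreover have "norm differentiable (at (pos s - a))"
      using that by (intro differentiable_norm_at) simp
    ultimately show ?thesis
      using differentiable_chain_at[of "\<lambda>s'. pos s' - a" s norm] by (simp add: o_def)
  qed
  have "(\<lambda>s'. obs_branch lam q r p0 (pos s') $ n) differentiable (at s)" for n
    unfolding obs_branch_def phase_diff_def vec_lambda_beta
    by (intro differentiable_add differentiable_mult differentiable_diff differentiable_const nrm assms)
  then show ?thesis
    by (subst differentiable_componentwise_within) (auto simp: Basis_vec_def inner_axis)
qed

end

theory Submission
  imports Defs "HOL-Probability.Distributions"
begin

text \<open>The score is the row vector \<open>\<sigma>\<^sup>-\<^sup>2 \<eta>\<^sup>T \<nabla>h\<close>, so the Fisher matrix follows from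
  the second moments \<open>\<sigma>\<^sup>2 I\<close> of the noise. The nth row of \<open>\<nabla>h\<close> is a multiple of the difference
  of the unit vectors pointing from \<open>q\<^sub>n\<close> and from \<open>r\<close> to the source, whose norm is at most
  \<open>2 \<parallel>q\<^sub>n - r\<parallel> / d\<close>.\<close>

section \<open>Second moments of isotropic Gaussian noise\<close>

text \<open>Fubini for product functions: \<open>lborel\<close> is the image of the product of
  one-dimensional Lebesgue measures under the map sending coordinates to the vector
  \<open>?T y\<close>.\<close>

lemma has_bochner_integral_lborel_prod:
  fixes f :: "'a::euclidean_space \<Rightarrow> real \<Rightarrow> real"
  assumes "\<And>b. b \<in> Basis \<Longrightarrow> has_bochner_integral lborel (f b) (c b)"
  shows "has_bochner_integral lborel (\<lambda>x. \<Prod>b\<in>Basis. f b (x \<bullet> b)) (\<Prod>b\<in>Basis. c b)"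
proof -
  interpret product_sigma_finite "\<lambda>b::'a. lborel :: real measure"
    by standard
  have int: "integrable lborel (f b)" "integral\<^sup>L lborel (f b) = c b" if "b \<in> Basis" for b
    using assms[OF that] by (simp_all add: has_bochner_integral_iff)
  have [measurable]: "f b \<in> borel_measurable borel" if "b \<in> Basis" for b
    using borel_measurable_integrable[OF int(1)[OF that]] by simp
  let ?T = "\<lambda>y :: 'a \<Rightarrow> real. \<Sum>b\<in>Basis. y b *\<^sub>R b"
  have "has_bochner_integral (\<Pi>\<^sub>M b\<in>Basis. lborel) (\<lambda>y. \<Prod>b\<in>Basis. f b (y b)) (\<Prod>b\<in>Basis. c b)"
    unfolding has_bochner_integral_iff
    using product_integrable_prod[of Basis f] product_integral_prod[of Basis f] int by simp
  then have "has_bochner_integral (\<Pi>\<^sub>M b\<in>Basis. lborel) (\<lambda>y. \<Prod>b\<in>Basis. f b (?T y \<bullet> b)) (\<Prod>b\<in>Basis. c b)"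
    by simp
  then show ?thesis
    by (subst lborel_eq, intro has_bochner_integral_distr) measurable
qed

text \<open>\<open>matrix_inv\<close> is a choice of a two-sided inverse. For square matrices a
  right inverse already gives invertibility, and cancelling on the left identifies the chosen
  matrix.\<close>

lemma matrix_inv_unique_right:
  fixes A B :: "real^'n^'n"
  assumes "A ** B = mat 1"
  shows "matrix_inv A = B"
proof -
  have "invertible A"
    using assms by (auto simp: invertible_right_inverse)
  then have "matrix_inv A ** A = mat 1"
    unfolding invertible_def matrix_inv_def by (rule someI_ex[THEN conjunct2])
  then have "matrix_inv A ** (A ** B) = B"
    by (simp add: matrix_mul_assoc)
  then show ?thesis
    by (simp add: assms)
qed

lemma matrix_inv_scaleR_mat_1:
  assumes "c \<noteq> 0"
  shows "matrix_inv (c *\<^sub>R mat 1 :: real^'n^'n) = (1 / c) *\<^sub>R mat 1"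
proof (rule matrix_inv_unique_right)
  show "(c *\<^sub>R mat 1) ** ((1 / c) *\<^sub>R mat 1) = (mat 1 :: real^'n^'n)"
    using assms by (simp add: matrix_scalar_ac flip: scalar_matrix_assoc)
qed

lemma det_scaleR_mat_1: "det (c *\<^sub>R mat 1 :: real^'n^'n) = c ^ CARD('n)"
  by (subst det_diagonal) (auto simp: mat_def)

lemma gaussian_density_isotropic:
  fixes \<mu> z :: "real^'n"
  assumes "0 < \<sigma>"
  shows "gaussian_density \<mu> (\<sigma>\<^sup>2 *\<^sub>R mat 1) z =
    exp (- ((z - \<mu>) \<bullet> (z - \<mu>)) / (2 * \<sigma>\<^sup>2)) / sqrt ((2 * pi * \<sigma>\<^sup>2) ^ CARD('n))"
  using assms
  by (simp add: gaussian_density_def matrix_inv_scaleR_mat_1 det_scaleR_mat_1 power_mult_distrib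
      flip: scaleR_matrix_vector_assoc)

text \<open>The squared norm in the exponent is a sum over coordinates, so the exponential
  factorises; this makes the product form of Fubini applicable to the noise law.\<close>

lemma gaussian_density_eq_prod_normal_density:
  fixes z :: "real^'n"
  assumes "0 < \<sigma>"
  shows "gaussian_density 0 (\<sigma>\<^sup>2 *\<^sub>R mat 1) z = (\<Prod>b\<in>Basis. normal_density 0 \<sigma> (z \<bullet> b))"
proof -
  have "z \<bullet> z = (\<Sum>b\<in>Basis. (z \<bullet> b)\<^sup>2)"
    by (subst euclidean_inner) (simp add: power2_eq_square)
  then show ?thesis
    unfolding gaussian_density_isotropic[OF assms]
    by (simp add: normal_density_def prod.distrib prod_dividef exp_sum[symmetric] sum_negf
        sum_divide_distrib real_sqrt_power power_one_over flip: sum_divide_distrib)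
qed

text \<open>Coordinates are independent and centred: for \<open>k \<noteq> l\<close> the first
  moment 0 occurs as a factor, while for \<open>k = l\<close> a single variance is multiplied by
  total masses 1.\<close>

lemma noise_law_second_moment:
  fixes k l :: "'n::finite"
  assumes "0 < \<sigma>"
  shows "has_bochner_integral (noise_law \<sigma>) (\<lambda>x::real^'n. x $ k * x $ l) (if k = l then \<sigma>\<^sup>2 else 0)"
proof -
  let ?e = "\<lambda>i::'n. axis i (1::real)"
  \<comment> \<open>Two separate conditionals, so that both fire when \<open>k = l\<close> and
    produce the square of the coordinate.\<close>
  define f where "f b x = normal_density 0 \<sigma> x *
      ((if b = ?e k then x else 1) * (if b = ?e l then x else 1))" for b x
  define c where "c b = (if b = ?e k \<and> b = ?e l then \<sigma>\<^sup>2 else if b = ?e k \<or> b = ?e l then 0 else 1)" for b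
  \<comment> \<open>The three cases of \<open>c\<close> are the second moment, the first moment and
    the total mass of a centred normal density.\<close>
  have "has_bochner_integral lborel (f b) (c b)" for b
    using normal_moment_even[OF assms, of 0 1] normal_moment_odd[OF assms, of 0 0]
      normal_moment_even[OF assms, of 0 0]
    unfolding f_def c_def
    by (auto simp: power2_eq_square fact_numeral)
  then have int: "has_bochner_integral lborel (\<lambda>x::real^'n. \<Prod>b\<in>Basis. f b (x \<bullet> b)) (\<Prod>b\<in>Basis. c b)"
    by (rule has_bochner_integral_lborel_prod)
  have e: "?e i \<in> Basis" for i
    by (simp add: axis_in_Basis_iff)
  have val: "(\<Prod>b\<in>Basis. c b) = (if k = l then \<sigma>\<^sup>2 else 0)"
  proof (cases "k = l")
    case True
    then have "c = (\<lambda>b. if b = ?e k then \<sigma>\<^sup>2 else 1)"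
      by (auto simp: c_def)
    then show ?thesis
      using True e by (simp add: prod.delta)
  next
    case False
    then have "c (?e k) = 0"
      by (simp add: c_def axis_eq_axis)
    then show ?thesis
      using False e prod_zero[of "Basis :: (real^'n) set" c] by auto
  qed
  have sel: "(\<Prod>b\<in>Basis. if b = ?e i then x \<bullet> b else 1) = x $ i" for i and x :: "real^'n"
    using e by (simp add: prod.delta inner_axis)
  have "(\<Prod>b\<in>Basis. f b (x \<bullet> b)) = gaussian_density 0 (\<sigma>\<^sup>2 *\<^sub>R mat 1) x * (x $ k * x $ l)" for x :: "real^'n"
    by (simp add: f_def prod.distrib sel gaussian_density_eq_prod_normal_density[OF assms])
  then have "has_bochner_integral lborel
      (\<lambda>x::real^'n. gaussian_density 0 (\<sigma>\<^sup>2 *\<^sub>R mat 1) x *\<^sub>R (x $ k * x $ l)) (if k = l then \<sigma>\<^sup>2 else 0)"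
    using int val by simp
  then show ?thesis
    unfolding noise_law_def
    by (intro has_bochner_integral_density)
       (auto simp: gaussian_density_isotropic[OF assms] intro!: borel_measurable_gaussian_density)
qed

section \<open>The score and its outer product\<close>

lemma jacobian_eq_matrix:
  fixes f :: "real^'m \<Rightarrow> real^'n"
  assumes "(f has_derivative f') (at x)"
  shows "jacobian f (at x) = matrix f'"
  using frechet_derivative_at[OF assms] by (simp add: jacobian_def)

lemma obs_branch_has_derivative:
  fixes q :: "'n::finite \<Rightarrow> real^3"
  assumes "pos s \<noteq> r" "\<And>n. pos s \<noteq> q n"
  shows "((\<lambda>s'. obs_branch lam q r (pos s) (pos s')) has_derivative (\<lambda>h. obs_jacobian lam q r s *v h)) (at s)"
  using obs_branch_differentiable[where q = q and lam = lam and ?p0.0 = "pos s", OF assms]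
  by (simp add: jacobian_works obs_jacobian_def)

text \<open>Up to the constant \<open>K\<close>, the log-likelihood is
  \<open>- 1 / (2 * \<sigma>\<^sup>2)\<close> times the squared norm of the residual; the chain rule
  gives the gradient.\<close>

lemma score_eq:
  fixes q :: "'n::finite \<Rightarrow> real^3"
  assumes "0 < \<sigma>" "pos s \<noteq> r" "\<And>n. pos s \<noteq> q n"
  shows "score \<sigma> lam q r s z =
    (\<chi> _ i. (\<Sum>n\<in>UNIV. (z - obs lam q r (pos s)) $ n * obs_jacobian lam q r s $ n $ i) / \<sigma>\<^sup>2)"
proof -
  define H where "H = obs_jacobian lam q r s"
  define g where "g s' = obs_branch lam q r (pos s) (pos s')" for s'
  define K where "K = ln (sqrt ((2 * pi * \<sigma>\<^sup>2) ^ CARD('n)))"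
  have g: "(g has_derivative (\<lambda>h. H *v h)) (at s)"
    using obs_branch_has_derivative[where q = q and r = r and s = s, OF assms(2,3)] unfolding g_def H_def .
  \<comment> \<open>At the base point the branch takes the wrapped value, so the residual
    \<open>z - g s\<close> is the actual noise.\<close>
  have gs: "g s = obs lam q r (pos s)"
    by (simp add: g_def)
  have "ln (likelihood \<sigma> (obs_branch lam q r (pos s)) s' z) = - ((z - g s') \<bullet> (z - g s')) / (2 * \<sigma>\<^sup>2) - K" for s'
    using assms(1) by (simp add: likelihood_def gaussian_density_isotropic g_def K_def ln_div)
  moreover have "((\<lambda>s'. - ((z - g s') \<bullet> (z - g s')) / (2 * \<sigma>\<^sup>2) - K) has_derivative
      (\<lambda>h. ((z - g s) \<bullet> (H *v h)) / \<sigma>\<^sup>2)) (at s)"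
    by (rule derivative_eq_intros g refl)+
       (use assms(1) in \<open>auto simp: inner_commute field_simps inner_diff_right inner_diff_left\<close>)
  ultimately have L: "((\<lambda>s'. ln (likelihood \<sigma> (obs_branch lam q r (pos s)) s' z)) has_derivative
      (\<lambda>h. ((z - g s) \<bullet> (H *v h)) / \<sigma>\<^sup>2)) (at s)"
    by simp
  have "bounded_linear (vec :: real \<Rightarrow> real^1)"
    by (intro linear_linear[THEN iffD2] linearI) (simp_all add: vec_eq_iff)
  from bounded_linear.has_derivative[OF this L]
  have "score \<sigma> lam q r s z = matrix (\<lambda>h. vec (((z - g s) \<bullet> (H *v h)) / \<sigma>\<^sup>2))"
    unfolding score_def by (rule jacobian_eq_matrix)
  then show ?thesis
    by (simp add: matrix_def vec_eq_iff gs inner_vec_def matrix_vector_mult_basis column_def H_def)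
qed

text \<open>The outer product is a finite sum of noise products with constant matrix coefficients,
  so it can be integrated termwise. Integrability is recorded along with the value, since the
  integral of a non-integrable function would default to 0.\<close>

lemma has_bochner_integral_score_outer_product:
  fixes q :: "'n::finite \<Rightarrow> real^3"
  assumes "0 < \<sigma>" "pos s \<noteq> r" "\<And>n. pos s \<noteq> q n"
  shows "has_bochner_integral (obs_law \<sigma> lam q r s)
    (\<lambda>z. transpose (score \<sigma> lam q r s z) ** score \<sigma> lam q r s z)
    ((1 / \<sigma>\<^sup>2) *\<^sub>R (transpose (obs_jacobian lam q r s) ** obs_jacobian lam q r s))"
proof -
  define H where "H = obs_jacobian lam q r s"
  define M :: "'n \<Rightarrow> 'n \<Rightarrow> real^6^6" where "M k l = (\<chi> i j. H $ k $ i * H $ l $ j / (\<sigma>\<^sup>2 * \<sigma>\<^sup>2))" for k l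
  define \<mu> where "\<mu> = obs lam q r (pos s)"
  have score: "transpose (score \<sigma> lam q r s z) ** score \<sigma> lam q r s z =
      (\<Sum>k\<in>UNIV. \<Sum>l\<in>UNIV. ((z - \<mu>) $ k * (z - \<mu>) $ l) *\<^sub>R M k l)" for z
    unfolding score_eq[where q = q and r = r and s = s, OF assms]
    by (simp add: vec_eq_iff matrix_matrix_mult_def transpose_def M_def H_def \<mu>_def sum_product
        sum_divide_distrib mult_ac)
  have "has_bochner_integral (noise_law \<sigma>)
      (\<lambda>x. \<Sum>k\<in>UNIV. \<Sum>l\<in>UNIV. (x $ k * x $ l) *\<^sub>R M k l)
      (\<Sum>k\<in>UNIV. \<Sum>l\<in>UNIV. (if k = l then \<sigma>\<^sup>2 else 0) *\<^sub>R M k l)"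
    by (intro has_bochner_integral_sum has_bochner_integral_scaleR_left noise_law_second_moment assms(1))
  \<comment> \<open>The two scores contribute \<open>1 / \<sigma> ^ 4\<close>, and the noise
    variance cancels half of it.\<close>
  moreover have "\<sigma>\<^sup>2 * x / \<sigma> ^ 4 = x / \<sigma>\<^sup>2" for x
    using assms(1) by (simp add: power2_eq_square power4_eq_xxxx)
  then have "(\<Sum>k\<in>UNIV. \<Sum>l\<in>UNIV. (if k = l then \<sigma>\<^sup>2 else 0) *\<^sub>R M k l) =
      (1 / \<sigma>\<^sup>2) *\<^sub>R (transpose H ** H)"
    using assms(1)
    by (simp add: if_distrib[of "\<lambda>c. c *\<^sub>R _"] sum.delta vec_eq_iff M_def matrix_matrix_mult_def transpose_def
        sum_divide_distrib cong: if_cong)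
  \<comment> \<open>Pulling back along \<open>\<eta> \<mapsto> \<mu> + \<eta>\<close> turns the
    residual \<open>z - \<mu>\<close> into the noise.\<close>
  ultimately show ?thesis
    unfolding score obs_law_def H_def[symmetric]
    by (intro has_bochner_integral_distr) (auto simp: \<mu>_def noise_law_def)
qed

section \<open>Decay of the Jacobian far from the reference\<close>

text \<open>The gradient of the distance to \<open>a\<close> is the unit vector
  \<open>sgn (pos s - a)\<close>. The factor \<open>pos (axis i 1)\<close> is 0 for the three
  velocity indices.\<close>

lemma obs_jacobian_nth:
  fixes q :: "'n::finite \<Rightarrow> real^3"
  assumes "pos s \<noteq> r" "\<And>n. pos s \<noteq> q n"
  shows "obs_jacobian lam q r s $ n $ i =
    2 * pi / lam * (pos (axis i 1) \<bullet> (sgn (pos s - q n) - sgn (pos s - r)))"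
proof -
  have nrm: "((\<lambda>s'. norm (pos s' - a)) has_derivative (\<lambda>h. pos h \<bullet> sgn (pos s - a))) (at s)"
    if "pos s \<noteq> a" for a
  proof -
    have "((\<lambda>s'. pos s' - a) has_derivative pos) (at s)"
      using has_derivative_diff[OF bounded_linear_imp_has_derivative[OF bounded_linear_pos] has_derivative_const]
      by simp
    then show ?thesis
      using has_derivative_compose[of "\<lambda>s'. pos s' - a" pos s UNIV norm "\<lambda>h. h \<bullet> sgn (pos s - a)"]
        has_derivative_norm[of "pos s - a"] that by simp
  qed
  have "((\<lambda>s'. phase_diff lam (q n) r (pos s')) has_derivative
      (\<lambda>h. 2 * pi / lam * (pos h \<bullet> sgn (pos s - q n) - pos h \<bullet> sgn (pos s - r)))) (at s)" for n
    unfolding phase_diff_def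
    by (intro has_derivative_mult_right has_derivative_diff nrm assms)
  then have "((\<lambda>s'. \<chi> n. phase_diff lam (q n) r (pos s')) has_derivative
      (\<lambda>h. \<chi> n. 2 * pi / lam * (pos h \<bullet> sgn (pos s - q n) - pos h \<bullet> sgn (pos s - r)))) (at s)"
    by (subst has_derivative_componentwise_within) (auto simp: Basis_vec_def inner_axis)
  from jacobian_eq_matrix[OF this] show ?thesis
    by (simp add: obs_jacobian_eq_phase_diff matrix_def inner_diff_right)
qed

text \<open>Bringing both unit vectors over the denominator \<open>norm b\<close> leaves
  \<open>a - b\<close> and a correction of size \<open>\<bar>norm b - norm a\<bar>\<close>; the
  reverse triangle inequality bounds the latter by \<open>norm (a - b)\<close>, whence the factor
  2.\<close>

lemma norm_sgn_diff_le:
  fixes a b :: "'a::real_normed_vector"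
  assumes "a \<noteq> 0" "b \<noteq> 0"
  shows "norm (sgn a - sgn b) \<le> 2 * norm (a - b) / norm b"
proof -
  have "sgn a - sgn b = (1 / norm b) *\<^sub>R ((a - b) + (norm b - norm a) *\<^sub>R sgn a)"
    using assms by (simp add: sgn_div_norm inverse_eq_divide algebra_simps)
  also have "norm \<dots> = norm ((a - b) + (norm b - norm a) *\<^sub>R sgn a) / norm b"
    by simp
  also have "norm ((a - b) + (norm b - norm a) *\<^sub>R sgn a) \<le> norm (a - b) + \<bar>norm b - norm a\<bar>"
    using norm_triangle_ineq[of "a - b" "(norm b - norm a) *\<^sub>R sgn a"] assms by (simp add: norm_sgn)
  also have "\<bar>norm b - norm a\<bar> \<le> norm (a - b)"
    using norm_triangle_ineq3[of a b] by simp
  finally show ?thesis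
    by (simp add: divide_right_mono)
qed

text \<open>The filter expresses that the distance to \<open>r\<close> tends to infinity, with
  direction and velocity free. It eventually excludes the points where derivatives may fail to
  exist.\<close>

lemma eventually_pos_neq:
  "\<forall>\<^sub>F s in filtercomap (\<lambda>s. norm (pos s - r)) at_top. pos s \<noteq> a"
proof -
  have "filterlim (\<lambda>s. norm (pos s - r)) at_top (filtercomap (\<lambda>s. norm (pos s - r)) at_top)"
    by (rule filterlim_filtercomap)
  then have "\<forall>\<^sub>F s in filtercomap (\<lambda>s. norm (pos s - r)) at_top. norm (a - r) < norm (pos s - r)"
    by (simp add: filterlim_at_top_dense)
  then show ?thesis
    by (rule eventually_mono) auto
qed

lemma obs_jacobian_tendsto_0:
  fixes q :: "'n::finite \<Rightarrow> real^3"
  shows "((\<lambda>s. obs_jacobian lam q r s $ n $ i) \<longlongrightarrow> 0) (filtercomap (\<lambda>s. norm (pos s - r)) at_top)"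
    (is "(_ \<longlongrightarrow> _) ?F")
proof (rule Lim_null_comparison)
  \<comment> \<open>The difference of \<open>pos s - q n\<close> and \<open>pos s - r\<close> is
    \<open>r - q n\<close>, independent of \<open>s\<close>, so \<open>?C\<close> is a
    constant.\<close>
  let ?C = "\<bar>2 * pi / lam\<bar> * (norm (pos (axis i 1)) * (2 * norm (r - q n)))"
  have "\<forall>\<^sub>F s in ?F. pos s \<noteq> r \<and> (\<forall>n. pos s \<noteq> q n)"
    by (intro eventually_conj eventually_all_finite eventually_pos_neq)
  then show "\<forall>\<^sub>F s in ?F. norm (obs_jacobian lam q r s $ n $ i) \<le> ?C / norm (pos s - r)"
  proof eventually_elim
    case (elim s)
    let ?w = "sgn (pos s - q n) - sgn (pos s - r)"
    have "\<bar>pos (axis i 1) \<bullet> ?w\<bar> \<le> norm (pos (axis i 1)) * norm ?w"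
      by (rule Cauchy_Schwarz_ineq2)
    also have "\<dots> \<le> norm (pos (axis i 1)) * (2 * norm (r - q n) / norm (pos s - r))"
      using norm_sgn_diff_le[of "pos s - q n" "pos s - r"] elim by (intro mult_left_mono) auto
    finally have "\<bar>2 * pi / lam\<bar> * \<bar>pos (axis i 1) \<bullet> ?w\<bar> \<le>
        \<bar>2 * pi / lam\<bar> * (norm (pos (axis i 1)) * (2 * norm (r - q n) / norm (pos s - r)))"
      by (rule mult_left_mono) simp
    then show ?case
      using elim by (simp add: obs_jacobian_nth abs_mult)
  qed
  show "((\<lambda>s. ?C / norm (pos s - r)) \<longlongrightarrow> 0) ?F"
    by (intro tendsto_divide_0[OF tendsto_const] filterlim_at_top_imp_at_infinity filterlim_filtercomap)
qed

theorem proposition1: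
  fixes lam \<sigma> :: real and r :: "real^3" and q :: "'n::finite \<Rightarrow> real^3"
  assumes "0 < lam" and "0 < \<sigma>"
  shows "(\<forall>s. pos s \<noteq> r \<and> (\<forall>n. pos s \<noteq> q n) \<longrightarrow>
           integrable (obs_law \<sigma> lam q r s)
             (\<lambda>z. transpose (score \<sigma> lam q r s z) ** score \<sigma> lam q r s z) \<and>
           data_fisher \<sigma> lam q r s =
             (1 / \<sigma>\<^sup>2) *\<^sub>R (transpose (obs_jacobian lam q r s) ** obs_jacobian lam q r s)) \<and>
         (data_fisher \<sigma> lam q r \<longlongrightarrow> 0) (filtercomap (\<lambda>s. norm (pos s - r)) at_top)"
proof
  let ?J = "\<lambda>s. (1 / \<sigma>\<^sup>2) *\<^sub>R (transpose (obs_jacobian lam q r s) ** obs_jacobian lam q r s)"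
  let ?F = "filtercomap (\<lambda>s. norm (pos s - r)) at_top"
  show fisher: "\<forall>s. pos s \<noteq> r \<and> (\<forall>n. pos s \<noteq> q n) \<longrightarrow>
      integrable (obs_law \<sigma> lam q r s) (\<lambda>z. transpose (score \<sigma> lam q r s z) ** score \<sigma> lam q r s z) \<and>
      data_fisher \<sigma> lam q r s = ?J s"
    using has_bochner_integral_score_outer_product[OF assms(2), where q = q and r = r and lam = lam]
    by (simp add: has_bochner_integral_iff data_fisher_def)
  have "\<forall>\<^sub>F s in ?F. pos s \<noteq> r \<and> (\<forall>n. pos s \<noteq> q n)"
    by (intro eventually_conj eventually_all_finite eventually_pos_neq)
  \<comment> \<open>The closed form is established only away from \<open>r\<close> and the antennas,
    which suffices for the limit.\<close>
  then have ev: "\<forall>\<^sub>F s in ?F. ?J s = data_fisher \<sigma> lam q r s"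
    by (rule eventually_mono) (use fisher in simp)
  have "((\<lambda>s. ?J s $ i $ j) \<longlongrightarrow> 0) ?F" for i j
    unfolding vector_scaleR_component matrix_matrix_mult_def transpose_def vec_lambda_beta
      real_scaleR_def
    by (intro tendsto_mult_right_zero tendsto_null_sum tendsto_mult_zero obs_jacobian_tendsto_0)
  then have "(?J \<longlongrightarrow> 0) ?F"
    by (intro vec_tendstoI) simp
  then show "(data_fisher \<sigma> lam q r \<longlongrightarrow> 0) ?F"
    using ev by (rule Lim_transform_eventually)
qed

end
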